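(* Let $T\ge 1$ and $n\ge 2$ be integers, let $\delta\in(0,1)$, and let $\mathfrak{B}_u:=\sup_{u\in\mathcal U}\|u\|$. Assume that $\Pi$ is a finite class of maps with $\pi^\star\in\Pi$ and $\pi(x)\in\mathcal U$ for all $\pi\in\Pi$ and $x\in\mathcal X$. Let $\hat\pi_{0:T-1}=(\hat\pi_0,\dots,\hat\pi_{T-1})$ be the time-varying controller produced by the Forward Training Algorithm with parameters $n,T$, expert $\pi^\star$ and class $\Pi$, and for $x_0\sim\mathcal D$ (independent of the training data) let $\hat x_t=\varphi_t(x_0;\hat\pi_{0:t-1})$. Then there is an event $\mathcal E$ of probability at least $1-\delta$ over the randomness in the training process under which $$\mathbb E\big[\,\|\pi^\star(\hat x_t)-\hat\pi_t(\hat x_t)\|\;\big|\;\hat\pi_{0:T-1}\big]\;\le\;\frac{7\,\mathfrak{B}_u\ln(2T|\Pi|/\delta)}{n_t}\qquad\text{for all } t\in\{0,\dots,T-1\},$$ where $n_t:=c\,n\,t\,\lceil\ln^2(t+1)\rceil+n$, $c:=\sum_{s=1}^\infty \frac{1}{s\ln^2(s+1)}$, and the expectation is over the randomness in the initial state $x_0$.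
   Context: Setting: control-affine dynamics $x_{t+1}=f(x_t)+g(x_t)u_t$ with states in $\mathcal X=\mathbb R^{d_x}$ (no state constraints) and inputs in $\mathcal U\subset\mathbb R^{d_u}$. $\mathcal D$ is a probability distribution of initial states. $\|\cdot\|$ is a fixed norm. For a time-varying feedback controller $\pi_{0:t-1}=(\pi_0,\dots,\pi_{t-1})$, $\varphi_t(x_0;\pi_{0:t-1})$ denotes the state at time $t$ when starting at $x_0$ and applying $u_s=\pi_s(x_s)$ for $s=0,\dots,t-1$. The expert $\pi^\star:\mathcal X\to\mathcal U$ is a fixed controller; $\Pi$ is a class of maps from states to inputs. Forward Training Algorithm with parameters $n,T$: for $t=0,1,\dots,T-1$ (stage $t$), given the already learned $\hat\pi_0,\dots,\hat\pi_{t-1}$, draw fresh i.i.d. initial states $x_0^{(1)},\dots,x_0^{(m_t)}\sim\mathcal D$ (independent of previous stages), where $m_t=\lceil n_t\rceil$, $n_t=c\,n\,t\,\lceil\ln^2(t+1)\rceil+n$ (so $n_0=n$) and $c=\sum_{s=1}^\infty\frac{1}{s\ln^2(s+1)}$; set $\hat x_t^{(i)}=\varphi_t(x_0^{(i)};\hat\pi_{0:t-1})$ (with $\hat x_0^{(i)}=x_0^{(i)}$); and choose $$\hat\pi_t\in\arg\min_{\pi\in\Pi}\frac1{m_t}\sum_{i=1}^{m_t}\|\pi^\star(\hat x_t^{(i)})-\pi(\hat x_t^{(i)})\|.$$ The output is $\hat\pi_{0:T-1}$. "Randomness in the training process" means the randomness of all the sampled initial states used by the algorithm. *)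

theory Defs
  imports "HOL-Probability.Probability"
begin

definition is_norm :: "('a::real_vector \<Rightarrow> real) \<Rightarrow> bool" where
  "is_norm N \<longleftrightarrow>
     (\<forall>x. 0 \<le> N x) \<and> (\<forall>x. N x = 0 \<longleftrightarrow> x = 0) \<and>
     (\<forall>a x. N (a *\<^sub>R x) = \<bar>a\<bar> * N x) \<and> (\<forall>x y. N (x + y) \<le> N x + N y)"

(* Extended-valued supremum: it is infinite for an unbounded input set, where the
   supremum in the reals would be unspecified. *)
definition input_bound :: "('u \<Rightarrow> real) \<Rightarrow> 'u set \<Rightarrow> ennreal" where
  "input_bound N U = (SUP u\<in>U. ennreal (N u))"

(* The series starts at s = 1, hence the shift to Suc s. *)
definition c_const :: real where
  "c_const = (\<Sum>s. 1 / (real (Suc s) * (ln (real (Suc s) + 1))\<^sup>2))"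

definition n_stage :: "nat \<Rightarrow> nat \<Rightarrow> real" where
  "n_stage n t = c_const * real n * real t * real_of_int \<lceil>(ln (real t + 1))\<^sup>2\<rceil> + real n"

definition m_stage :: "nat \<Rightarrow> nat \<Rightarrow> nat" where
  "m_stage n t = nat \<lceil>n_stage n t\<rceil>"

(* State at time t of x_(s+1) = f x_s + g x_s u_s under u_s = p s x_s; only the
   controllers p 0, ..., p (t - 1) are used. *)
primrec rollout ::
  "(real^'dx \<Rightarrow> real^'dx) \<Rightarrow> (real^'dx \<Rightarrow> real^'du^'dx) \<Rightarrow>
   (nat \<Rightarrow> real^'dx \<Rightarrow> real^'du) \<Rightarrow> real^'dx \<Rightarrow> nat \<Rightarrow> real^'dx" where
  "rollout f g p x0 0 = x0"
| "rollout f g p x0 (Suc t) =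
     f (rollout f g p x0 t) + g (rollout f g p x0 t) *v p t (rollout f g p x0 t)"

definition empirical_loss ::
  "('u::minus \<Rightarrow> real) \<Rightarrow> ('x \<Rightarrow> 'u) \<Rightarrow> nat \<Rightarrow> (nat \<Rightarrow> 'x) \<Rightarrow> ('x \<Rightarrow> 'u) \<Rightarrow> real" where
  "empirical_loss N expert m xs p = 1 / real m * (\<Sum>i<m. N (expert (xs i) - p (xs i)))"

(* Samples drawn in stages 0, ..., k - 1; the m_stage n s samples of stage s are
   numbered from 0. *)
definition sample_index :: "nat \<Rightarrow> nat \<Rightarrow> (nat \<times> nat) set" where
  "sample_index n k = (SIGMA s:{..<k}. {..<m_stage n s})"

definition training_data ::
  "(nat \<Rightarrow> nat \<Rightarrow> 'w \<Rightarrow> 'x) \<Rightarrow> nat \<Rightarrow> nat \<Rightarrow> 'w \<Rightarrow> (nat \<times> nat \<Rightarrow> 'x)" where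
  "training_data X n k w = (\<lambda>(s, i)\<in>sample_index n k. X s i w)"

(* The sigma-algebra generated by the samples of stages 0, ..., k - 1. *)
definition training_algebra ::
  "'w measure \<Rightarrow> (nat \<Rightarrow> nat \<Rightarrow> 'w \<Rightarrow> 'x::topological_space) \<Rightarrow> nat \<Rightarrow> nat \<Rightarrow> 'w measure" where
  "training_algebra M X n k =
     vimage_algebra (space M) (training_data X n k) (\<Pi>\<^sub>M j\<in>sample_index n k. borel)"

(* The sigma-algebra generated by the learned controllers ph 0, ..., ph (T - 1),
   where the class P carries its discrete sigma-algebra. *)
definition controller_algebra ::
  "'w measure \<Rightarrow> 'p set \<Rightarrow> nat \<Rightarrow> (nat \<Rightarrow> 'w \<Rightarrow> 'p) \<Rightarrow> 'w measure" where
  "controller_algebra M P T ph =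
     vimage_algebra (space M) (\<lambda>w. \<lambda>t\<in>{..<T}. ph t w) (\<Pi>\<^sub>M t\<in>{..<T}. count_space P)"

(* X t i is the i-th initial state drawn in stage t and ph t the controller learned in
   stage t, both as random elements on M. Ties between minimizers may be broken in any
   way, as long as ph t is a measurable function of the samples of stages 0, ..., t; a
   choice that depends on later samples would not be a run of the algorithm. *)
definition forward_training ::
  "'w measure \<Rightarrow> (real^'dx) measure \<Rightarrow> (real^'dx \<Rightarrow> real^'dx) \<Rightarrow> (real^'dx \<Rightarrow> real^'du^'dx) \<Rightarrow>
   (real^'du \<Rightarrow> real) \<Rightarrow> (real^'dx \<Rightarrow> real^'du) \<Rightarrow> (real^'dx \<Rightarrow> real^'du) set \<Rightarrow> nat \<Rightarrow> nat \<Rightarrow>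
   (nat \<Rightarrow> nat \<Rightarrow> 'w \<Rightarrow> real^'dx) \<Rightarrow> (nat \<Rightarrow> 'w \<Rightarrow> real^'dx \<Rightarrow> real^'du) \<Rightarrow> bool" where
  "forward_training M D f g N expert P n T X ph \<longleftrightarrow>
     prob_space.indep_vars M (\<lambda>_. borel) (\<lambda>(t, i). X t i) (sample_index n T) \<and>
     (\<forall>t<T. \<forall>i<m_stage n t. distr M borel (X t i) = D) \<and>
     (\<forall>t<T. ph t \<in> measurable (training_algebra M X n (Suc t)) (count_space P)) \<and>
     (\<forall>t<T. \<forall>w\<in>space M.
        is_arg_min
          (empirical_loss N expert (m_stage n t)
             (\<lambda>i. rollout f g (\<lambda>s. ph s w) (X t i w) t))
          (\<lambda>p. p \<in> P) (ph t w))"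

end

theory Submission
  imports Defs
begin

text \<open>
  The expert belongs to the class and has empirical loss zero, so every learned controller has
  empirical loss zero as well: at stage \<open>t\<close> it coincides with the expert at all of the
  \<open>m_stage n t\<close> sampled states. This is the realizable case of learning with a finite class,
  where the error decays like the inverse of the sample size, and not like its square root.

  Fix a value \<open>p\<close> of the earlier controllers and call a controller \<open>q\<close> inaccurate if, with
  \<open>D\<close>-probability more than \<open>\<epsilon>\<close>, it differs from the expert at the state reached at time
  \<open>t\<close> under \<open>p\<close>. The samples of stage \<open>t\<close> are independent of the earlier stages, so even
  conditionally on the history being \<open>p\<close> an inaccurate \<open>q\<close> passes all of them with probability
  at most \<open>(1 - \<epsilon>) ^ m_stage n t\<close>. A union bound over \<open>q\<close> and a sum over the disjoint
  events "the history is \<open>p\<close>" show that the learned controller is inaccurate with probability at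
  most \<open>|P| exp (- \<epsilon> m_stage n t)\<close> (lemma \<open>prob_bad_stage\<close>). The choice
  \<open>\<epsilon> = ln (T |P| / \<delta>) / n_stage n t\<close> turns this into \<open>\<delta> / T\<close>, and the \<open>T\<close> stages
  together fail with probability at most \<open>\<delta>\<close>.

  It remains to pass from disagreement to conditional expected loss. The initial state \<open>x0\<close> is
  independent of the training data and the controllers take finitely many values, so conditioning
  on them amounts to integrating over \<open>x0\<close> with the controllers held fixed
  (lemma \<open>nn_cond_exp_indep_argument\<close>). Two inputs differ in norm by at most twice the input
  bound, and by nothing where they agree, so this integral is at most
  \<open>2 * input_bound N U\<close> times the probability of disagreement (lemma \<open>expected_loss_le\<close>).
  The constant 2 obtained in this way is below the 7 of the statement.
\<close>

section \<open>Stage sizes\<close>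

text \<open>
  The value of a divergent series is unspecified, so even the sign of \<open>c_const\<close> rests on
  convergence. Cauchy condensation turns the terms into \<open>1 / (ln (2 ^ k + 1))\<^sup>2\<close>, which are
  of order \<open>1 / k\<^sup>2\<close>.
\<close>

lemma c_const_nonneg: "0 \<le> c_const"
proof -
  define f :: "nat \<Rightarrow> real" where "f k = 1 / (real k * (ln (real k + 1))\<^sup>2)" for k
  have "summable f \<longleftrightarrow> summable (\<lambda>k. 2 ^ k * f (2 ^ k))"
  proof (rule condensation_test)
    fix m :: nat assume m: "0 < m"
    have "real m * (ln (real m + 1))\<^sup>2 \<le> real (Suc m) * (ln (real (Suc m) + 1))\<^sup>2"
      by (intro mult_mono power_mono) auto
    then show "f (Suc m) \<le> f m"
      unfolding f_def using m by (intro divide_left_mono mult_pos_pos) auto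
  qed (simp add: f_def)
  moreover have "summable (\<lambda>k. 2 ^ k * f (2 ^ k))"
  proof (rule summable_comparison_test')
    show "summable (\<lambda>k. inverse ((real k) ^ 2) / (ln 2)\<^sup>2)"
      by (intro summable_divide inverse_power_summable) simp
    fix k :: nat assume k: "1 \<le> k"
    have "real k * ln 2 \<le> ln (2 ^ k + 1)"
      by (subst ln_realpow[symmetric]) (auto simp: add_pos_pos intro!: ln_mono)
    then have "(real k * ln 2)\<^sup>2 \<le> (ln (2 ^ k + 1))\<^sup>2"
      by (intro power_mono) auto
    moreover have "0 < (real k * ln 2)\<^sup>2"
      using k by simp
    ultimately have "1 / (ln (2 ^ k + 1))\<^sup>2 \<le> 1 / (real k * ln 2)\<^sup>2"
      by (intro divide_left_mono mult_pos_pos) linarith+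
    then show "norm (2 ^ k * f (2 ^ k)) \<le> inverse ((real k) ^ 2) / (ln 2)\<^sup>2"
      by (simp add: f_def power_mult_distrib field_simps)
  qed
  ultimately have "summable (\<lambda>s. f (Suc s))"
    by (simp only: summable_Suc_iff)
  then show ?thesis
    unfolding c_const_def f_def by (intro suminf_nonneg) auto
qed

lemma n_stage_pos: "0 < n \<Longrightarrow> 0 < n_stage n t"
  unfolding n_stage_def
  by (intro add_nonneg_pos mult_nonneg_nonneg c_const_nonneg)
     (auto simp: zero_le_ceiling intro: order_less_le_trans[of _ 0])

lemma n_stage_le_m_stage: "n_stage n t \<le> real (m_stage n t)"
  unfolding m_stage_def by linarith

section \<open>Measurability of rollouts and of the norm\<close>

lemma rollout_cong:
  "(\<And>s. s < t \<Longrightarrow> p s = q s) \<Longrightarrow> rollout f g p x t = rollout f g q x t"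
  by (induction t) auto

lemma borel_measurable_matrix_vector_mult:
  fixes A :: "'a \<Rightarrow> real^'n^'m" and v :: "'a \<Rightarrow> real^'n"
  assumes "A \<in> borel_measurable S" and "v \<in> borel_measurable S"
  shows "(\<lambda>x. A x *v v x) \<in> borel_measurable S"
proof (rule borel_measurable_continuous_Pair[OF assms])
  show "continuous_on UNIV (\<lambda>z :: (real^'n^'m) \<times> (real^'n). fst z *v snd z)"
    unfolding matrix_vector_mult_def by (intro continuous_intros)
qed

lemma borel_measurable_rollout:
  assumes "f \<in> borel_measurable borel" and "g \<in> borel_measurable borel"
    and "\<And>s. s < t \<Longrightarrow> p s \<in> borel_measurable borel"
  shows "(\<lambda>x. rollout f g p x t) \<in> borel_measurable borel"
  using assms(3)
proof (induction t)
  case (Suc t)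
  then have [measurable]: "(\<lambda>x. rollout f g p x t) \<in> borel_measurable borel"
    "p t \<in> borel_measurable borel" by auto
  note assms(1,2)[measurable]
  show ?case
    by (simp, intro borel_measurable_add borel_measurable_matrix_vector_mult) measurable
qed simp

text \<open>A norm is convex, and convex functions on a finite-dimensional space are continuous.\<close>

lemma is_norm_measurable:
  fixes N :: "'a::euclidean_space \<Rightarrow> real"
  assumes "is_norm N"
  shows "N \<in> borel_measurable borel"
proof -
  have "convex_on UNIV N"
  proof (rule convex_onI)
    fix t :: real and x y :: 'a assume t: "0 < t" "t < 1"
    have "N ((1 - t) *\<^sub>R x + t *\<^sub>R y) \<le> N ((1 - t) *\<^sub>R x) + N (t *\<^sub>R y)"
      using assms unfolding is_norm_def by blast
    also have "\<dots> = (1 - t) * N x + t * N y"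
      using assms t unfolding is_norm_def by simp
    finally show "N ((1 - t) *\<^sub>R x + t *\<^sub>R y) \<le> (1 - t) * N x + t * N y" .
  qed simp
  then show ?thesis
    by (intro borel_measurable_continuous_onI convex_on_continuous) auto
qed

lemma is_norm_diff_le:
  assumes "is_norm N" "u \<in> U" "v \<in> U"
  shows "ennreal (N (u - v)) \<le> 2 * input_bound N U * of_bool (u \<noteq> v)"
proof (cases "u = v")
  case True
  then show ?thesis using assms(1) by (simp add: is_norm_def)
next
  case False
  have "N (- v) = N v"
    using assms(1) unfolding is_norm_def
    by (metis abs_1 abs_minus_cancel mult_1 scaleR_minus1_left)
  then have "N (u - v) \<le> N u + N v"
    using assms(1) unfolding is_norm_def by (metis diff_conv_add_uminus)
  then have "ennreal (N (u - v)) \<le> ennreal (N u) + ennreal (N v)"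
    using assms(1) unfolding is_norm_def by (metis ennreal_leI ennreal_plus)
  also have "\<dots> \<le> input_bound N U + input_bound N U"
    unfolding input_bound_def using assms(2,3) by (intro add_mono SUP_upper)
  finally show ?thesis
    using False by (simp add: mult_2)
qed

section \<open>Conditional expectation with an independent argument\<close>

text \<open>
  Independence of \<open>A\<close> and \<open>Y\<close> says that the law of \<open>Y\<close> under \<open>M\<close> restricted to \<open>A\<close>
  is the law of \<open>Y\<close> scaled by the mass of \<open>A\<close>; integrating \<open>h\<close> against both laws gives the
  identity.
\<close>

lemma (in prob_space) nn_integral_indicator_indep:
  fixes Y :: "'a \<Rightarrow> 'b"
  assumes A: "A \<in> events" and Y: "Y \<in> measurable M S" and h: "h \<in> borel_measurable S"
    and indep: "\<And>B. B \<in> sets S \<Longrightarrow>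
      prob (A \<inter> (Y -` B \<inter> space M)) = prob A * prob (Y -` B \<inter> space M)"
  shows "(\<integral>\<^sup>+w. indicator A w * h (Y w) \<partial>M) = emeasure M A * (\<integral>\<^sup>+y. h y \<partial>distr M S Y)"
proof -
  note [measurable] = A Y h
  have law: "distr (density M (indicator A)) S Y = scale_measure (emeasure M A) (distr M S Y)"
  proof (rule measure_eqI)
    fix B assume "B \<in> sets (distr (density M (indicator A)) S Y)"
    then have B[measurable]: "B \<in> sets S" by simp
    have "emeasure (distr (density M (indicator A)) S Y) B
        = emeasure (density M (indicator A)) (Y -` B \<inter> space M)"
      by (subst emeasure_distr) auto
    also have "\<dots> = (\<integral>\<^sup>+w. indicator A w * indicator (Y -` B \<inter> space M) w \<partial>M)"
      by (subst emeasure_density) auto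
    also have "\<dots> = (\<integral>\<^sup>+w. indicator (A \<inter> (Y -` B \<inter> space M)) w \<partial>M)"
      by (intro nn_integral_cong) (auto simp: indicator_def)
    also have "\<dots> = emeasure M (A \<inter> (Y -` B \<inter> space M))"
      by (rule nn_integral_indicator) measurable
    also have "\<dots> = emeasure M A * emeasure M (Y -` B \<inter> space M)"
      by (simp add: emeasure_eq_measure indep[OF B] ennreal_mult)
    finally show "emeasure (distr (density M (indicator A)) S Y) B
        = emeasure (scale_measure (emeasure M A) (distr M S Y)) B"
      by (simp add: emeasure_distr)
  qed simp
  have "(\<integral>\<^sup>+w. indicator A w * h (Y w) \<partial>M) = (\<integral>\<^sup>+w. h (Y w) \<partial>density M (indicator A))"
    by (subst nn_integral_density) auto
  also have "\<dots> = (\<integral>\<^sup>+y. h y \<partial>distr (density M (indicator A)) S Y)"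
    by (subst nn_integral_distr) auto
  also have "\<dots> = emeasure M A * (\<integral>\<^sup>+y. h y \<partial>distr M S Y)"
    by (simp add: law nn_integral_scale_measure)
  finally show ?thesis .
qed

text \<open>
  The freezing rule: given \<open>F\<close>, a quantity \<open>H\<close> known to \<open>F\<close> is held fixed and the
  independent \<open>Y\<close> is integrated out. As \<open>H\<close> takes finitely many values,
  splitting over its level sets reduces the defining property of the conditional
  expectation to the previous lemma, applied to the event \<open>A\<close> cut down to one level set.
\<close>

lemma (in prob_space) nn_cond_exp_indep_argument:
  fixes H :: "'a \<Rightarrow> 'h" and Y :: "'a \<Rightarrow> 'b" and L :: "'h \<Rightarrow> 'b \<Rightarrow> ennreal"
  assumes F: "subalgebra M F" and K: "finite K"
    and H: "\<And>w. w \<in> space M \<Longrightarrow> H w \<in> K"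
    and level: "\<And>k. k \<in> K \<Longrightarrow> {w \<in> space M. H w = k} \<in> sets F"
    and Y: "Y \<in> measurable M S"
    and L: "\<And>k. k \<in> K \<Longrightarrow> L k \<in> borel_measurable S"
    and indep: "\<And>A B. A \<in> sets F \<Longrightarrow> B \<in> sets S \<Longrightarrow>
      prob (A \<inter> (Y -` B \<inter> space M)) = prob A * prob (Y -` B \<inter> space M)"
  shows "AE w in M. nn_cond_exp M F (\<lambda>w. L (H w) (Y w)) w
    = (\<integral>\<^sup>+y. L (H w) y \<partial>distr M S Y)"
proof -
  interpret finite_measure_subalgebra M F
    by unfold_locales (rule F)
  define G where "G k = {w \<in> space M. H w = k}" for k
  define R where "R k = (\<integral>\<^sup>+y. L k y \<partial>distr M S Y)" for k
  have GF[measurable]: "G k \<in> sets F" if "k \<in> K" for k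
    using level[OF that] by (simp add: G_def)
  have GM: "G k \<in> events" if "k \<in> K" for k
    using GF[OF that] F by (auto simp: subalgebra_def)
  have spF: "space F = space M" using F by (simp add: subalgebra_def)
  have split: "\<phi> (H w) = (\<Sum>k\<in>K. indicator (G k) w * \<phi> k)"
    if "w \<in> space M" for w and \<phi> :: "'h \<Rightarrow> ennreal"
    using K H[OF that] that
    by (subst sum.remove[of K "H w"]) (auto simp: G_def indicator_def intro!: sum.neutral)
  have LY: "(\<lambda>w. L k (Y w)) \<in> borel_measurable M" if "k \<in> K" for k
    using L[OF that] Y by measurable
  have meas: "(\<lambda>w. L (H w) (Y w)) \<in> borel_measurable M"
  proof (subst measurable_cong)
    show "L (H w) (Y w) = (\<Sum>k\<in>K. indicator (G k) w * L k (Y w))" if "w \<in> space M" for w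
      using split[OF that, of "\<lambda>k. L k (Y w)"] .
    show "(\<lambda>w. \<Sum>k\<in>K. indicator (G k) w * L k (Y w)) \<in> borel_measurable M"
      by (intro borel_measurable_sum borel_measurable_times_ennreal borel_measurable_indicator GM LY)
  qed
  have measR: "(\<lambda>w. R (H w)) \<in> borel_measurable F"
  proof (subst measurable_cong)
    show "R (H w) = (\<Sum>k\<in>K. indicator (G k) w * R k)" if "w \<in> space F" for w
      using split[of w R] that spF by simp
    show "(\<lambda>w. \<Sum>k\<in>K. indicator (G k) w * R k) \<in> borel_measurable F"
      by (intro borel_measurable_sum borel_measurable_times_ennreal borel_measurable_indicator GF
          borel_measurable_const)
  qed
  have "AE w in M. R (H w) = nn_cond_exp M F (\<lambda>w. L (H w) (Y w)) w"
  proof (rule nn_cond_exp_charact[OF _ meas measR])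
    fix A assume A: "A \<in> sets F"
    then have AM: "A \<in> events" using F by (auto simp: subalgebra_def)
    have "(\<integral>\<^sup>+w\<in>A. L (H w) (Y w) \<partial>M)
        = (\<integral>\<^sup>+w. (\<Sum>k\<in>K. indicator (A \<inter> G k) w * L k (Y w)) \<partial>M)"
    proof (rule nn_integral_cong)
      fix w assume w: "w \<in> space M"
      show "L (H w) (Y w) * indicator A w = (\<Sum>k\<in>K. indicator (A \<inter> G k) w * L k (Y w))"
        by (subst split[OF w, of "\<lambda>k. L k (Y w)"])
           (simp add: sum_distrib_left sum_distrib_right indicator_inter_arith mult_ac)
    qed
    also have "\<dots> = (\<Sum>k\<in>K. \<integral>\<^sup>+w. indicator (A \<inter> G k) w * L k (Y w) \<partial>M)"
      using AM GM LY by (intro nn_integral_sum) auto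
    also have "\<dots> = (\<Sum>k\<in>K. emeasure M (A \<inter> G k) * R k)"
      unfolding R_def
      using A AM GM GF by (intro sum.cong refl nn_integral_indicator_indep Y L indep) auto
    also have "\<dots> = (\<Sum>k\<in>K. \<integral>\<^sup>+w. R k * indicator (A \<inter> G k) w \<partial>M)"
      using AM GM by (intro sum.cong refl) (simp add: nn_integral_cmult_indicator mult.commute)
    also have "\<dots> = (\<integral>\<^sup>+w. (\<Sum>k\<in>K. R k * indicator (A \<inter> G k) w) \<partial>M)"
      using AM GM by (intro nn_integral_sum[symmetric]) auto
    also have "\<dots> = (\<integral>\<^sup>+w\<in>A. R (H w) \<partial>M)"
    proof (rule nn_integral_cong)
      fix w assume w: "w \<in> space M"
      show "(\<Sum>k\<in>K. R k * indicator (A \<inter> G k) w) = R (H w) * indicator A w"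
        by (subst split[OF w, of R])
           (simp add: sum_distrib_left sum_distrib_right indicator_inter_arith mult_ac)
    qed
    finally show "(\<integral>\<^sup>+w\<in>A. L (H w) (Y w) \<partial>M) = (\<integral>\<^sup>+w\<in>A. R (H w) \<partial>M)" .
  qed
  then show ?thesis
    unfolding R_def by (rule AE_mp) (auto intro!: AE_I2)
qed

section \<open>Training data and learned controllers\<close>

lemma sample_index_mono: "k \<le> l \<Longrightarrow> sample_index n k \<subseteq> sample_index n l"
  unfolding sample_index_def by auto

lemma space_training_algebra [simp]: "space (training_algebra M X n k) = space M"
  by (simp add: training_algebra_def)

lemma measurable_training_data:
  "training_data X n k \<in> measurable (training_algebra M X n k) (\<Pi>\<^sub>M j\<in>sample_index n k. borel)"
  unfolding training_algebra_def
  by (rule measurable_vimage_algebra1) (auto simp: training_data_def space_PiM)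

lemma sets_training_algebra_mono:
  assumes "k \<le> l"
  shows "sets (training_algebra M X n k) \<subseteq> sets (training_algebra M X n l)"
proof -
  have "(\<lambda>w. restrict (training_data X n l w) (sample_index n k))
      \<in> measurable (training_algebra M X n l) (\<Pi>\<^sub>M j\<in>sample_index n k. borel)"
    by (rule measurable_compose[OF measurable_training_data
          measurable_restrict_subset[OF sample_index_mono[OF assms]]])
  moreover have "(\<lambda>w. restrict (training_data X n l w) (sample_index n k)) = training_data X n k"
    using sample_index_mono[OF assms, of n]
    by (auto simp: training_data_def restrict_def fun_eq_iff)
  ultimately have "training_data X n k
      \<in> measurable (training_algebra M X n l) (\<Pi>\<^sub>M j\<in>sample_index n k. borel)"
    by simp
  then show ?thesis
    unfolding training_algebra_def[of M X n k] by (intro sets_image_in_sets) auto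
qed


locale forward_training_run = prob_space M
  for M :: "'w measure" +
  fixes D :: "(real^'dx) measure"
    and f :: "real^'dx \<Rightarrow> real^'dx"
    and g :: "real^'dx \<Rightarrow> real^'du^'dx"
    and N :: "real^'du \<Rightarrow> real"
    and expert :: "real^'dx \<Rightarrow> real^'du"
    and P :: "(real^'dx \<Rightarrow> real^'du) set"
    and n T :: nat
    and X :: "nat \<Rightarrow> nat \<Rightarrow> 'w \<Rightarrow> real^'dx"
    and ph :: "nat \<Rightarrow> 'w \<Rightarrow> real^'dx \<Rightarrow> real^'du"
  assumes prob_space_D: "prob_space D" and sets_D: "sets D = sets borel"
    and f_measurable: "f \<in> borel_measurable borel"
    and g_measurable: "g \<in> borel_measurable borel"
    and norm_N: "is_norm N"
    and finite_P: "finite P" and expert_P: "expert \<in> P"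
    and P_measurable: "\<And>p. p \<in> P \<Longrightarrow> p \<in> borel_measurable borel"
    and n_pos: "0 < n"
    and run: "forward_training M D f g N expert P n T X ph"
begin

abbreviation histories :: "nat \<Rightarrow> (nat \<Rightarrow> real^'dx \<Rightarrow> real^'du) set" where
  "histories k \<equiv> {..<k} \<rightarrow>\<^sub>E P"

definition history :: "nat \<Rightarrow> 'w \<Rightarrow> nat \<Rightarrow> real^'dx \<Rightarrow> real^'du" where
  "history k w = (\<lambda>s\<in>{..<k}. ph s w)"

text \<open>
  Initial states from which the controllers \<open>p\<close>, run up to time \<open>t\<close>, lead to a state where
  \<open>q\<close> and the expert choose the same input.
\<close>

definition agreement ::
  "(nat \<Rightarrow> real^'dx \<Rightarrow> real^'du) \<Rightarrow> nat \<Rightarrow> (real^'dx \<Rightarrow> real^'du) \<Rightarrow> (real^'dx) set" where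
  "agreement p t q = {x. expert (rollout f g p x t) = q (rollout f g p x t)}"

lemma agreement_cong:
  "(\<And>s. s < t \<Longrightarrow> p s = p' s) \<Longrightarrow> agreement p t q = agreement p' t q"
  unfolding agreement_def using rollout_cong[of t p p' f g] by simp

lemma rollout_measurable:
  assumes "\<And>s. s < t \<Longrightarrow> p s \<in> P"
  shows "(\<lambda>x. rollout f g p x t) \<in> borel_measurable borel"
  using assms by (intro borel_measurable_rollout f_measurable g_measurable P_measurable)

lemma agreement_measurable:
  assumes "\<And>s. s < t \<Longrightarrow> p s \<in> P" and "q \<in> P"
  shows "agreement p t q \<in> sets borel"
proof -
  note [measurable] = rollout_measurable[OF assms(1)] P_measurable[OF assms(2)]
    P_measurable[OF expert_P]
  have "{x \<in> space borel. expert (rollout f g p x t) = q (rollout f g p x t)} \<in> sets borel"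
    using assms(1) by measurable
  then show ?thesis by (simp add: agreement_def)
qed

lemma samples_indep: "indep_vars (\<lambda>_. borel) (\<lambda>(t, i). X t i) (sample_index n T)"
  using run by (simp add: forward_training_def)

lemma sample_measurable:
  assumes "t < T" "i < m_stage n t"
  shows "X t i \<in> borel_measurable M"
proof -
  have "(t, i) \<in> sample_index n T" using assms by (auto simp: sample_index_def)
  then show ?thesis using samples_indep unfolding indep_vars_def2 by fastforce
qed

lemma training_data_measurable:
  assumes "k \<le> T"
  shows "training_data X n k \<in> measurable M (\<Pi>\<^sub>M j\<in>sample_index n k. borel)"
proof -
  have "(\<lambda>w. \<lambda>j\<in>sample_index n k. (case j of (s, i) \<Rightarrow> X s i) w)
      \<in> measurable M (\<Pi>\<^sub>M j\<in>sample_index n k. borel)"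
    using assms by (intro measurable_restrict) (auto simp: sample_index_def intro!: sample_measurable)
  also have "(\<lambda>w. \<lambda>j\<in>sample_index n k. (case j of (s, i) \<Rightarrow> X s i) w) = training_data X n k"
    by (auto simp: training_data_def fun_eq_iff restrict_def)
  finally show ?thesis .
qed

lemma sets_training_algebra_events:
  "k \<le> T \<Longrightarrow> sets (training_algebra M X n k) \<subseteq> events"
  unfolding training_algebra_def
  by (intro sets_image_in_sets training_data_measurable) auto

lemma ph_in_P: "t < T \<Longrightarrow> w \<in> space M \<Longrightarrow> ph t w \<in> P"
  using run unfolding forward_training_def is_arg_min_def by blast

lemma ph_measurable:
  assumes "t < k" "k \<le> T"
  shows "ph t \<in> measurable (training_algebra M X n k) (count_space P)"
proof -
  have *: "ph t \<in> measurable (training_algebra M X n (Suc t)) (count_space P)"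
    using run assms by (simp add: forward_training_def)
  show ?thesis
    by (rule measurable_mono[THEN subsetD, OF _ _ _ _ *])
       (use sets_training_algebra_mono[of "Suc t" k] assms in auto)
qed

lemma history_measurable:
  "k \<le> T \<Longrightarrow> history k \<in> measurable (training_algebra M X n k) (\<Pi>\<^sub>M s\<in>{..<k}. count_space P)"
  unfolding history_def by (intro measurable_restrict ph_measurable) auto

lemma history_in: "k \<le> T \<Longrightarrow> w \<in> space M \<Longrightarrow> history k w \<in> histories k"
  using ph_in_P by (auto simp: history_def)

lemma sets_singleton_history:
  assumes "p \<in> histories k"
  shows "{p} \<in> sets (\<Pi>\<^sub>M s\<in>{..<k}. count_space P)"
proof -
  have "(\<Pi>\<^sub>E s\<in>{..<k}. {p s}) \<in> sets (\<Pi>\<^sub>M s\<in>{..<k}. count_space P)"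
    using assms by (intro sets_PiM_I_finite) auto
  also have "(\<Pi>\<^sub>E s\<in>{..<k}. {p s}) = {p}"
    using assms by (intro PiE_singleton) (auto simp: PiE_def)
  finally show ?thesis .
qed

lemma history_level_set:
  assumes "k \<le> T" "p \<in> histories k"
  shows "{w \<in> space M. history k w = p} \<in> sets (training_algebra M X n k)"
  using measurable_sets[OF history_measurable[OF assms(1)] sets_singleton_history[OF assms(2)]]
  by (simp add: vimage_def Int_def conj_commute)

lemma finite_histories: "finite (histories k)"
  using finite_P by (intro finite_PiE) auto

section \<open>Accuracy of the controller learned in one stage\<close>

text \<open>
  The samples are one independent family indexed by pairs of stage and number. The indices with
  stage below \<open>t\<close> and those of stage \<open>t\<close> are disjoint, so the two blocks are independent;
  inside the second block the probability of the joint event is a product.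
\<close>

lemma prob_stage_samples_in:
  assumes t: "t < T" and G: "G \<in> sets (training_algebra M X n t)" and S: "S \<in> sets borel"
  shows "prob (G \<inter> {w \<in> space M. \<forall>i<m_stage n t. X t i w \<in> S})
    = prob G * measure D S ^ m_stage n t"
proof -
  let ?Y = "\<lambda>j. case j of (s, i) \<Rightarrow> X s i" and ?J = "{t} \<times> {..<m_stage n t}"
  let ?C = "{w \<in> space M. \<forall>i<m_stage n t. X t i w \<in> S}"
  have sub: "sample_index n t \<subseteq> sample_index n T" "?J \<subseteq> sample_index n T"
    and disj: "sample_index n t \<inter> ?J = {}"
    using t by (auto simp: sample_index_def)
  have past: "(\<lambda>w. \<lambda>j\<in>sample_index n t. ?Y j w) = training_data X n t"
    by (auto simp: training_data_def fun_eq_iff restrict_def)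
  obtain B where B: "B \<in> sets (\<Pi>\<^sub>M j\<in>sample_index n t. borel)"
    and GB: "G = training_data X n t -` B \<inter> space M"
    using G unfolding training_algebra_def
    by (subst (asm) sets_vimage_algebra2) (auto simp: training_data_def space_PiM)
  have CB: "?C = (\<lambda>w. \<lambda>j\<in>?J. ?Y j w) -` (\<Pi>\<^sub>E j\<in>?J. S) \<inter> space M"
  proof (intro set_eqI iffI)
    fix w assume "w \<in> ?C"
    then show "w \<in> (\<lambda>w. \<lambda>j\<in>?J. ?Y j w) -` (\<Pi>\<^sub>E j\<in>?J. S) \<inter> space M"
      by (auto intro!: restrict_PiE_iff[THEN iffD2])
  next
    fix w assume w: "w \<in> (\<lambda>w. \<lambda>j\<in>?J. ?Y j w) -` (\<Pi>\<^sub>E j\<in>?J. S) \<inter> space M"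
    then have "?Y j w \<in> S" if "j \<in> ?J" for j
      using that by (simp only: vimage_eq Int_iff restrict_PiE_iff)
    from this[of "(t, _)"] w show "w \<in> ?C" by simp
  qed
  have iv: "indep_var (\<Pi>\<^sub>M j\<in>sample_index n t. borel) (training_data X n t)
      (\<Pi>\<^sub>M j\<in>?J. borel) (\<lambda>w. \<lambda>j\<in>?J. ?Y j w)"
    using indep_var_restrict[OF samples_indep disj sub] by (simp only: past)
  have "prob (G \<inter> ?C)
      = prob ((\<lambda>w. (training_data X n t w, \<lambda>j\<in>?J. ?Y j w)) -` (B \<times> (\<Pi>\<^sub>E j\<in>?J. S)) \<inter> space M)"
    unfolding GB CB by (intro arg_cong[where f = prob]) auto
  also have "\<dots> = prob G * prob ?C"
    unfolding GB CB using S by (intro indep_varD[OF iv B] sets_PiM_I_finite) auto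
  also have "prob ?C = measure D S ^ m_stage n t"
  proof (cases "m_stage n t = 0")
    case True
    then show ?thesis by (simp add: prob_space)
  next
    case False
    have "?C = (\<Inter>j\<in>?J. ?Y j -` S \<inter> space M)"
      using False by auto
    also have "prob \<dots> = (\<Prod>j\<in>?J. prob (?Y j -` S \<inter> space M))"
      using False S sub by (intro indep_varsD[OF samples_indep]) auto
    also have "\<dots> = (\<Prod>j\<in>?J. measure D S)"
    proof (rule prod.cong[OF refl])
      fix j assume "j \<in> ?J"
      then obtain i where j: "j = (t, i)" and i: "i < m_stage n t" by auto
      have "distr M borel (X t i) = D"
        using run t i by (simp add: forward_training_def)
      then show "prob (?Y j -` S \<inter> space M) = measure D S"
        using measure_distr[OF sample_measurable[OF t i] S] j by simp
    qed
    also have "\<dots> = measure D S ^ m_stage n t" by simp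
    finally show ?thesis .
  qed
  finally show ?thesis .
qed

text \<open>
  The loss of the learned controller is at most that of the expert, which is zero; and a sum of
  norms vanishes only if each of them does.
\<close>

lemma ph_agrees_on_samples:
  assumes t: "t < T" and w: "w \<in> space M" and i: "i < m_stage n t"
  shows "X t i w \<in> agreement (history t w) t (ph t w)"
proof -
  let ?xs = "\<lambda>i. rollout f g (\<lambda>s. ph s w) (X t i w) t"
  let ?loss = "empirical_loss N expert (m_stage n t) ?xs"
  have nonneg: "0 \<le> N u" and zero: "N u = 0 \<longleftrightarrow> u = 0" for u
    using norm_N by (auto simp: is_norm_def)
  have "is_arg_min ?loss (\<lambda>p. p \<in> P) (ph t w)"
    using run t w by (simp add: forward_training_def)
  then have "?loss (ph t w) \<le> ?loss expert"
    using expert_P by (auto simp: is_arg_min_linorder)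
  also have "?loss expert = 0"
    using zero[of 0] by (simp add: empirical_loss_def)
  finally have "(\<Sum>i<m_stage n t. N (expert (?xs i) - ph t w (?xs i))) \<le> 0"
    using i by (simp add: empirical_loss_def mult_le_0_iff divide_le_0_iff)
  moreover have "0 \<le> (\<Sum>i<m_stage n t. N (expert (?xs i) - ph t w (?xs i)))"
    by (intro sum_nonneg nonneg)
  ultimately have "(\<Sum>i<m_stage n t. N (expert (?xs i) - ph t w (?xs i))) = 0"
    by linarith
  then have "N (expert (?xs i) - ph t w (?xs i)) = 0"
    using i by (subst (asm) sum_nonneg_eq_0_iff) (auto simp: nonneg)
  then have "X t i w \<in> agreement (\<lambda>s. ph s w) t (ph t w)"
    by (simp add: agreement_def zero)
  then show ?thesis
    by (subst agreement_cong[of t "history t w" "\<lambda>s. ph s w"]) (auto simp: history_def)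
qed

lemma agreement_history:
  assumes "t < T"
  shows "agreement (history T w) t (history T w t) = agreement (history t w) t (ph t w)"
  using assms agreement_cong[of t "history T w" "history t w"]
  by (simp add: history_def)

text \<open>
  The event that the controller learned in stage \<open>t\<close> differs from the expert with probability
  more than \<open>\<epsilon>\<close> along the trajectories of the controllers learned before it.
\<close>

definition bad_stage :: "nat \<Rightarrow> real \<Rightarrow> 'w set" where
  "bad_stage t \<epsilon> =
     {w \<in> space M. measure D (agreement (history t w) t (ph t w)) < 1 - \<epsilon>}"

lemma bad_stage_sets:
  assumes t: "t < T"
  shows "bad_stage t \<epsilon> \<in> events"
proof -
  let ?K = "{k \<in> histories T. measure D (agreement k t (k t)) < 1 - \<epsilon>}"
  have "bad_stage t \<epsilon> = (\<Union>k\<in>?K. {w \<in> space M. history T w = k})"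
    unfolding bad_stage_def using agreement_history[OF t] history_in[of T] by auto
  moreover have "finite ?K" using finite_histories by auto
  ultimately show ?thesis
    using history_level_set[of T] sets_training_algebra_events[of T]
    by (auto intro!: sets.finite_UN)
qed

text \<open>
  The learned controller depends on the samples of stage \<open>t\<close>, so the product formula does not
  apply to it directly. It does apply to each fixed inaccurate \<open>q\<close>, and one of these must have
  passed every sample. The events \<open>G p\<close> that the history is \<open>p\<close> are disjoint, so their
  probabilities add up to at most 1 and only the factor \<open>card P\<close> from the choice of \<open>q\<close>
  remains.
\<close>

lemma prob_bad_stage:
  fixes \<epsilon> :: real
  assumes t: "t < T"
  shows "prob (bad_stage t \<epsilon>) \<le> card P * exp (- \<epsilon> * m_stage n t)"
proof -
  interpret D: prob_space D by (rule prob_space_D)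
  let ?m = "m_stage n t"
  define G where "G p = {w \<in> space M. history t w = p}" for p
  define C where "C p q = {w \<in> space M. \<forall>i<?m. X t i w \<in> agreement p t q}" for p q
  define Q where "Q p = {q \<in> P. measure D (agreement p t q) < 1 - \<epsilon>}" for p
  have G: "G p \<in> sets (training_algebra M X n t)" if "p \<in> histories t" for p
    unfolding G_def using t that by (intro history_level_set) auto
  have GM: "G p \<in> events" if "p \<in> histories t" for p
    using G[OF that] sets_training_algebra_events[of t] t by auto
  have agr: "agreement p t q \<in> sets borel" if "p \<in> histories t" "q \<in> P" for p q
    using that by (intro agreement_measurable) auto
  have CM: "C p q \<in> events" if pq: "p \<in> histories t" "q \<in> P" for p q
  proof -
    have "{w \<in> space M. X t i w \<in> agreement p t q} \<in> events" if i: "i \<in> {..<?m}" for i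
      using measurable_sets[OF sample_measurable[OF t] agr[OF pq], of i] i
      by (simp add: vimage_def Int_def conj_commute)
    then have "{w \<in> space M. \<forall>i\<in>{..<?m}. X t i w \<in> agreement p t q} \<in> events"
      by (intro sets.sets_Collect_finite_All finite_lessThan)
    then show ?thesis by (simp only: C_def Ball_def lessThan_iff)
  qed
  have finQ: "finite (Q p)" for p by (simp add: Q_def finite_P)
  have "bad_stage t \<epsilon> \<subseteq> (\<Union>p\<in>histories t. \<Union>q\<in>Q p. G p \<inter> C p q)"
  proof
    fix w assume "w \<in> bad_stage t \<epsilon>"
    then have w: "w \<in> space M" and d: "measure D (agreement (history t w) t (ph t w)) < 1 - \<epsilon>"
      by (auto simp: bad_stage_def)
    have "history t w \<in> histories t" using history_in t w by auto
    moreover have "ph t w \<in> Q (history t w)" using ph_in_P[OF t w] d by (simp add: Q_def)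
    moreover have "w \<in> G (history t w) \<inter> C (history t w) (ph t w)"
      using ph_agrees_on_samples[OF t w] w by (auto simp: G_def C_def)
    ultimately show "w \<in> (\<Union>p\<in>histories t. \<Union>q\<in>Q p. G p \<inter> C p q)" by blast
  qed
  then have "prob (bad_stage t \<epsilon>) \<le> prob (\<Union>p\<in>histories t. \<Union>q\<in>Q p. G p \<inter> C p q)"
    using finite_histories finQ GM CM
    by (intro finite_measure_mono sets.finite_UN sets.Int) (auto simp: Q_def)
  also have "\<dots> \<le> (\<Sum>p\<in>histories t. prob (\<Union>q\<in>Q p. G p \<inter> C p q))"
    using finite_histories finQ GM CM
    by (intro finite_measure_subadditive_finite) (auto simp: Q_def intro!: sets.finite_UN sets.Int)
  also have "\<dots> \<le> (\<Sum>p\<in>histories t. prob (G p) * (card P * exp (- \<epsilon> * ?m)))"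
  proof (rule sum_mono)
    fix p assume p: "p \<in> histories t"
    have "prob (\<Union>q\<in>Q p. G p \<inter> C p q) \<le> (\<Sum>q\<in>Q p. prob (G p \<inter> C p q))"
      using finQ GM[OF p] CM[OF p]
      by (intro finite_measure_subadditive_finite) (auto simp: Q_def)
    also have "\<dots> \<le> (\<Sum>q\<in>Q p. prob (G p) * exp (- \<epsilon> * ?m))"
    proof (rule sum_mono)
      fix q assume q: "q \<in> Q p"
      have "prob (G p \<inter> C p q) = prob (G p) * measure D (agreement p t q) ^ ?m"
        unfolding C_def using q by (intro prob_stage_samples_in t G p agr) (auto simp: Q_def)
      \<comment> \<open>By \<open>1 - \<epsilon> \<le> exp (- \<epsilon>)\<close>.\<close>
      also have "measure D (agreement p t q) ^ ?m \<le> exp (- \<epsilon>) ^ ?m"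
        using q exp_ge_add_one_self[of "- \<epsilon>"] by (intro power_mono) (auto simp: Q_def)
      also have "exp (- \<epsilon>) ^ ?m = exp (- \<epsilon> * ?m)"
        by (simp add: exp_of_nat_mult[symmetric] mult.commute)
      finally show "prob (G p \<inter> C p q) \<le> prob (G p) * exp (- \<epsilon> * ?m)"
        by (simp add: mult_left_mono)
    qed
    also have "\<dots> = card (Q p) * (prob (G p) * exp (- \<epsilon> * ?m))" by simp
    also have "\<dots> \<le> card P * (prob (G p) * exp (- \<epsilon> * ?m))"
      using card_mono[OF finite_P, of "Q p"] by (intro mult_right_mono) (auto simp: Q_def)
    finally show "prob (\<Union>q\<in>Q p. G p \<inter> C p q) \<le> prob (G p) * (card P * exp (- \<epsilon> * ?m))"
      by (simp add: mult_ac)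
  qed
  also have "\<dots> = prob (\<Union>p\<in>histories t. G p) * (card P * exp (- \<epsilon> * ?m))"
    using finite_histories GM
    by (subst finite_measure_finite_Union) (auto simp: disjoint_family_on_def G_def sum_distrib_right)
  also have "\<dots> \<le> 1 * (card P * exp (- \<epsilon> * ?m))"
    by (intro mult_right_mono prob_le_1) auto
  finally show ?thesis by simp
qed

section \<open>Conditional expected loss given the learned controllers\<close>

lemma expected_loss_le:
  assumes p: "p \<in> histories T" and t: "t < T" and U: "\<forall>q\<in>P. \<forall>x. q x \<in> U"
  shows "(\<integral>\<^sup>+x. ennreal (N (expert (rollout f g p x t) - p t (rollout f g p x t))) \<partial>D)
    \<le> 2 * input_bound N U * ennreal (1 - measure D (agreement p t (p t)))"
proof -
  interpret D: prob_space D by (rule prob_space_D)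
  have spD: "space D = UNIV" using sets_eq_imp_space_eq[OF sets_D] by simp
  have pt: "p t \<in> P" using PiE_mem[OF p, of t] t by simp
  have "p s \<in> P" if "s < t" for s
    using PiE_mem[OF p, of s] t that by simp
  then have A: "agreement p t (p t) \<in> sets D"
    unfolding sets_D using pt by (rule agreement_measurable)
  have "(\<integral>\<^sup>+x. ennreal (N (expert (rollout f g p x t) - p t (rollout f g p x t))) \<partial>D)
      \<le> (\<integral>\<^sup>+x. 2 * input_bound N U * indicator (space D - agreement p t (p t)) x \<partial>D)"
  proof (rule nn_integral_mono)
    fix x
    show "ennreal (N (expert (rollout f g p x t) - p t (rollout f g p x t)))
        \<le> 2 * input_bound N U * indicator (space D - agreement p t (p t)) x"
      using is_norm_diff_le[OF norm_N, of "expert (rollout f g p x t)" U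
          "p t (rollout f g p x t)"] U expert_P pt
      by (auto simp: indicator_def agreement_def spD)
  qed
  also have "\<dots> = 2 * input_bound N U * emeasure D (space D - agreement p t (p t))"
    using A by (intro nn_integral_cmult_indicator) auto
  also have "emeasure D (space D - agreement p t (p t))
      = ennreal (1 - measure D (agreement p t (p t)))"
    by (simp add: D.emeasure_eq_measure D.prob_compl[OF A])
  finally show ?thesis .
qed

lemma space_controller_algebra: "space (controller_algebra M P T ph) = space M"
  by (simp add: controller_algebra_def)

lemma sets_controller_algebra_subset:
  "sets (controller_algebra M P T ph) \<subseteq> sets (training_algebra M X n T)"
  unfolding controller_algebra_def
  using history_measurable[of T] by (intro sets_image_in_sets) (auto simp: history_def[abs_def])

lemma subalgebra_controller_algebra: "subalgebra M (controller_algebra M P T ph)"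
  unfolding subalgebra_def space_controller_algebra
  using sets_controller_algebra_subset sets_training_algebra_events[of T] by auto

lemma history_level_set_controller_algebra:
  assumes "p \<in> histories T"
  shows "{w \<in> space M. history T w = p} \<in> sets (controller_algebra M P T ph)"
proof -
  have "(\<lambda>w. \<lambda>t\<in>{..<T}. ph t w) -` {p} \<inter> space M \<in> sets (controller_algebra M P T ph)"
    unfolding controller_algebra_def by (intro in_vimage_algebra sets_singleton_history assms)
  then show ?thesis
    by (simp add: history_def vimage_def Int_def conj_commute)
qed

text \<open>
  The loss at time \<open>t\<close> is a function of the complete history of controllers and of \<open>x0\<close>, and
  the former generates the sigma-algebra conditioned on. The freezing rule turns the conditional
  expectation into the integral that the previous bound treats.
\<close>

lemma nn_cond_exp_loss_le:
  assumes t: "t < T" and U: "\<forall>q\<in>P. \<forall>x. q x \<in> U"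
    and x0: "x0 \<in> borel_measurable M" and law: "distr M borel x0 = D"
    and indep: "indep_set (sets (vimage_algebra (space M) x0 borel))
      (sets (training_algebra M X n T))"
  shows "AE w in M. nn_cond_exp M (controller_algebra M P T ph)
      (\<lambda>w. let xt = rollout f g (\<lambda>s. ph s w) (x0 w) t in ennreal (N (expert xt - ph t w xt))) w
    \<le> 2 * input_bound N U * ennreal (1 - measure D (agreement (history t w) t (ph t w)))"
proof -
  define L where "L p x = ennreal (N (expert (rollout f g p x t) - p t (rollout f g p x t)))"
    for p x
  have "rollout f g (history T w) x t = rollout f g (\<lambda>s. ph s w) x t" for w x
    using t by (intro rollout_cong) (auto simp: history_def)
  then have loss: "(\<lambda>w. let xt = rollout f g (\<lambda>s. ph s w) (x0 w) t
      in ennreal (N (expert xt - ph t w xt))) = (\<lambda>w. L (history T w) (x0 w))"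
    using t by (simp add: L_def history_def Let_def)
  have "AE w in M. nn_cond_exp M (controller_algebra M P T ph) (\<lambda>w. L (history T w) (x0 w)) w
      = (\<integral>\<^sup>+x. L (history T w) x \<partial>distr M borel x0)"
  proof (rule nn_cond_exp_indep_argument[where K = "histories T"])
    fix p assume p: "p \<in> histories T"
    have "(\<lambda>x. rollout f g p x t) \<in> borel_measurable borel"
      using PiE_mem[OF p] t by (intro rollout_measurable) simp
    moreover have "p t \<in> borel_measurable borel"
      using PiE_mem[OF p, of t] t by (intro P_measurable) simp
    moreover note P_measurable[OF expert_P] is_norm_measurable[OF norm_N]
    ultimately show "L p \<in> borel_measurable borel"
      unfolding L_def[abs_def] by measurable
  next
    fix A B assume A: "A \<in> sets (controller_algebra M P T ph)" and B: "B \<in> sets (borel :: (real^'dx) measure)"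
    have "prob ((x0 -` B \<inter> space M) \<inter> A) = prob (x0 -` B \<inter> space M) * prob A"
      using A B sets_controller_algebra_subset
      by (intro indep_setD[OF indep] in_vimage_algebra) auto
    then show "prob (A \<inter> (x0 -` B \<inter> space M)) = prob A * prob (x0 -` B \<inter> space M)"
      by (simp add: Int_commute mult.commute)
  qed (use history_in[OF order_refl] in \<open>simp_all add: subalgebra_controller_algebra
      finite_histories history_level_set_controller_algebra x0\<close>)
  then show ?thesis
    unfolding loss law
  proof (rule AE_mp, intro AE_I2 impI)
    fix w assume w: "w \<in> space M"
      and eq: "nn_cond_exp M (controller_algebra M P T ph) (\<lambda>w. L (history T w) (x0 w)) w
        = (\<integral>\<^sup>+x. L (history T w) x \<partial>D)"
    show "nn_cond_exp M (controller_algebra M P T ph) (\<lambda>w. L (history T w) (x0 w)) w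
        \<le> 2 * input_bound N U * ennreal (1 - measure D (agreement (history t w) t (ph t w)))"
      using expected_loss_le[OF history_in[OF order_refl w] t U]
      by (subst eq) (simp only: L_def[abs_def] agreement_history[OF t])
  qed
qed

end

section \<open>All stages together\<close>

theorem theorem2p1:
  fixes f :: "real^'dx \<Rightarrow> real^'dx"
    and g :: "real^'dx \<Rightarrow> real^'du^'dx"
    and U :: "(real^'du) set"
    and N :: "real^'du \<Rightarrow> real"
    and D :: "(real^'dx) measure"
    and expert :: "real^'dx \<Rightarrow> real^'du"
    and P :: "(real^'dx \<Rightarrow> real^'du) set"
    and T n :: nat and \<delta> :: real
    and M :: "'w measure"
    and X :: "nat \<Rightarrow> nat \<Rightarrow> 'w \<Rightarrow> real^'dx"
    and ph :: "nat \<Rightarrow> 'w \<Rightarrow> real^'dx \<Rightarrow> real^'du"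
    and x0 :: "'w \<Rightarrow> real^'dx"
  assumes "T \<ge> 1" and "n \<ge> 2" and "0 < \<delta>" and "\<delta> < 1"
    and "is_norm N"
    and "prob_space D" and "sets D = sets borel"
    and "f \<in> borel_measurable borel" and "g \<in> borel_measurable borel"
    and "finite P" and "expert \<in> P"
    and "\<forall>p\<in>P. p \<in> borel_measurable borel"
    and "\<forall>p\<in>P. \<forall>x. p x \<in> U"
    and "prob_space M"
    and "forward_training M D f g N expert P n T X ph"
    and "x0 \<in> borel_measurable M" and "distr M borel x0 = D"
    and "prob_space.indep_set M (sets (vimage_algebra (space M) x0 borel))
           (sets (training_algebra M X n T))"
  shows "\<exists>E\<in>sets (training_algebra M X n T).
           measure M E \<ge> 1 - \<delta> \<and>
           (\<forall>w\<in>E. \<forall>t<T.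
              nn_cond_exp M (controller_algebra M P T ph)
                (\<lambda>w'. let xt = rollout f g (\<lambda>s. ph s w') (x0 w') t
                      in ennreal (N (expert xt - ph t w' xt))) w
              \<le> 7 * input_bound N U * ennreal (ln (2 * real T * real (card P) / \<delta>))
                  / ennreal (n_stage n t))"
proof -
  interpret forward_training_run M D f g N expert P n T X ph
    using assms by (intro forward_training_run.intro forward_training_run_axioms.intro) simp_all
  have U: "\<forall>q\<in>P. \<forall>x. q x \<in> U" by fact
  let ?F = "controller_algebra M P T ph"
  let ?loss = "\<lambda>t w. let xt = rollout f g (\<lambda>s. ph s w) (x0 w) t
      in ennreal (N (expert xt - ph t w xt))"
  let ?bound = "\<lambda>t. 7 * input_bound N U * ennreal (ln (2 * real T * real (card P) / \<delta>))
      / ennreal (n_stage n t)"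
  let ?risk = "\<lambda>t w. 2 * input_bound N U
      * ennreal (1 - measure D (agreement (history t w) t (ph t w)))"
  \<comment> \<open>The accuracies \<open>\<epsilon> t\<close> solve \<open>|P| exp (- \<epsilon> t * n_stage n t) = \<delta> / T\<close>. The event
      \<open>E\<close> is defined by the conclusion and not as the complement of \<open>Bad\<close>: a conditional
      expectation is determined only up to null sets, so the bound may fail at some points outside
      \<open>Bad\<close>.\<close>
  define l where "l = ln (real T * real (card P) / \<delta>)"
  define \<epsilon> where "\<epsilon> t = l / n_stage n t" for t
  define E where "E = {w \<in> space M. \<forall>t<T. nn_cond_exp M ?F (?loss t) w \<le> ?bound t}"
  define Bad where "Bad = (\<Union>t<T. bad_stage t (\<epsilon> t))"
  have "0 < card P"
    using finite_P expert_P by (auto simp: card_gt_0_iff)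
  then have card_P: "1 \<le> real (card P)" by simp
  have "1 \<le> real T * real (card P)"
    using mult_mono[of 1 "real T" 1 "real (card P)"] card_P \<open>T \<ge> 1\<close> by simp
  then have TP: "1 \<le> real T * real (card P) / \<delta>"
    using \<open>0 < \<delta>\<close> \<open>\<delta> < 1\<close> by (simp add: le_divide_eq)
  then have l_nonneg: "0 \<le> l" by (simp add: l_def)
  have l_le: "l \<le> ln (2 * real T * real (card P) / \<delta>)"
    unfolding l_def using TP \<open>0 < \<delta>\<close> by (intro ln_mono) (auto simp: divide_le_cancel)
  have ns: "0 < n_stage n t" for t by (rule n_stage_pos[OF n_pos])

  have bad_le: "prob (bad_stage t (\<epsilon> t)) \<le> \<delta> / real T" if "t < T" for t
  proof -
    have "l \<le> \<epsilon> t * real (m_stage n t)"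
      using mult_left_mono[OF n_stage_le_m_stage[of n t] l_nonneg] ns[of t]
      by (simp add: \<epsilon>_def le_divide_eq)
    then have "real (card P) * exp (- \<epsilon> t * real (m_stage n t)) \<le> real (card P) * exp (- l)"
      by (intro mult_left_mono) auto
    also have "exp (- l) = inverse (real T * real (card P) / \<delta>)"
      unfolding l_def using TP by (simp add: exp_minus)
    also have "real (card P) * \<dots> = \<delta> / real T"
      using card_P by (simp add: field_simps)
    finally show ?thesis using prob_bad_stage[OF that, of "\<epsilon> t"] by linarith
  qed
  have Bad_sets: "Bad \<in> events"
    unfolding Bad_def by (intro sets.finite_UN) (auto intro: bad_stage_sets)
  have "prob Bad \<le> (\<Sum>t<T. prob (bad_stage t (\<epsilon> t)))"
    unfolding Bad_def
    by (intro finite_measure_subadditive_finite) (auto intro: bad_stage_sets)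
  also have "\<dots> \<le> (\<Sum>t<T. \<delta> / real T)"
    by (intro sum_mono bad_le) auto
  also have "\<dots> = \<delta>" using \<open>T \<ge> 1\<close> by simp
  finally have prob_Bad: "prob Bad \<le> \<delta>" .

  have good: "?risk t w \<le> ?bound t" if "t < T" "w \<in> space M - Bad" for t w
  proof -
    have "w \<notin> bad_stage t (\<epsilon> t)"
      using that by (auto simp: Bad_def)
    then have "1 - measure D (agreement (history t w) t (ph t w)) \<le> \<epsilon> t"
      using that by (auto simp: bad_stage_def not_less)
    then have "?risk t w \<le> 2 * input_bound N U * ennreal (\<epsilon> t)"
      by (intro mult_left_mono ennreal_leI) auto
    also have "\<dots> = 2 * input_bound N U * ennreal l / ennreal (n_stage n t)"
      unfolding \<epsilon>_def by (simp add: divide_ennreal[symmetric] l_nonneg ns ennreal_times_divide)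
    also have "\<dots> \<le> ?bound t"
      using l_le by (intro divide_right_mono_ennreal mult_mono ennreal_leI) auto
    finally show ?thesis .
  qed

  have "{w \<in> space ?F. \<forall>t\<in>{..<T}. nn_cond_exp M ?F (?loss t) w \<le> ?bound t} \<in> sets ?F"
    by measurable
  then have "E \<in> sets ?F"
    by (simp only: E_def space_controller_algebra Ball_def lessThan_iff)
  then have E_training: "E \<in> sets (training_algebra M X n T)"
    using sets_controller_algebra_subset by blast
  have "AE w in M. \<forall>t\<in>{..<T}. nn_cond_exp M ?F (?loss t) w \<le> ?risk t w"
    using nn_cond_exp_loss_le[OF _ U, of _ x0] assms by (intro AE_finite_allI) auto
  then have "AE w in M. w \<in> space M - Bad \<longrightarrow> w \<in> E"
  proof (rule AE_mp, intro AE_I2 impI)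
    fix w assume le: "\<forall>t\<in>{..<T}. nn_cond_exp M ?F (?loss t) w \<le> ?risk t w"
      and w: "w \<in> space M - Bad"
    have "nn_cond_exp M ?F (?loss t) w \<le> ?bound t" if "t < T" for t
      using le good[OF that w] that by (meson lessThan_iff order_trans)
    then show "w \<in> E" unfolding E_def using w by blast
  qed
  then have "prob (space M - Bad) \<le> prob E"
    using E_training sets_training_algebra_events[of T] by (intro finite_measure_mono_AE) auto
  then have "1 - \<delta> \<le> prob E"
    using prob_compl[OF Bad_sets] prob_Bad by linarith
  moreover have "\<forall>w\<in>E. \<forall>t<T. nn_cond_exp M ?F (?loss t) w \<le> ?bound t"
    unfolding E_def by blast
  ultimately show ?thesis
    using E_training by blast
qed

end
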